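(* Let $\mathfrak X_0,\mathfrak X_1,\ldots\in\mathbb I_{\mathrm c}^n$ and $\mathfrak Y_0,\mathfrak Y_1,\ldots\in\mathbb I_{\mathrm c}^n$ be tight information tubes (for the same control system, with compact elements). If the initial information ensembles are intrinsically equivalent, $\mathfrak X_0\sim\mathfrak Y_0$, then $\mathfrak X_k\sim\mathfrak Y_k$ for all $k\in\mathbb N$.
   Context: $\mathbb K_{\mathrm c}^n$ is the set of compact subsets of $\mathbb R^n$ (including $\varnothing$) with the Hausdorff distance $d_{\mathrm H}$ induced by a norm on $\mathbb R^n$; $d_{\mathrm H}(\varnothing,\varnothing)=0$ and $d_{\mathrm H}(X,\varnothing)=\infty$ for $X\ne\varnothing$. Closures, closedness and compactness of subsets of $\mathbb K_{\mathrm c}^n$ are with respect to $d_{\mathrm H}$. An information ensemble is a nonempty set $\mathfrak X\subseteq\mathbb K_{\mathrm c}^n$ such that $X\cap Y\in\mathfrak X$ for all $X\in\mathfrak X$ and $Y\in\mathbb K_{\mathrm c}^n$. $\mathbb I^n$ (resp. $\mathbb I_{\mathrm c}^n$) denotes the set of closed (resp. compact) information ensembles. For collections $\mathfrak X,\mathfrak Y$ put $\mathfrak X\sqcap\mathfrak Y=\{X\cap Y\mid X\in\mathfrak X,\ Y\in\mathfrak Y\}$. Intrinsic equivalence: for $X,Y\in\mathbb K_{\mathrm c}^n$ write $X\simeq Y$ if there is $a\in\mathbb R^n$ with $X+a=Y$. Information ensembles $\mathfrak X,\mathfrak Y$ are intrinsically equivalent, $\mathfrak X\sim\mathfrak Y$,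 if $(\mathfrak X/\simeq)=(\mathfrak Y/\simeq)$, i.e. for every $X\in\mathfrak X$ there is $a\in\mathbb R^n$ with $X+a\in\mathfrak Y$, and for every $Y\in\mathfrak Y$ there is $b\in\mathbb R^n$ with $Y+b\in\mathfrak X$. System: $x_{k+1}=Ax_k+Bu_k+w_k$, $\eta_k=Cx_k+v_k$, with given real matrices $A\in\mathbb R^{n\times n}$, $B\in\mathbb R^{n\times n_u}$, $C\in\mathbb R^{n_v\times n}$ and given compact sets $\mathbb U\subseteq\mathbb R^{n_u}$ (controls $u_k$), $\mathbb W\subseteq\mathbb R^n$ (disturbances $w_k$), $\mathbb V\subseteq\mathbb R^{n_v}$ (measurement errors $v_k$). Define $$\mathfrak V=\{X\in\mathbb K_{\mathrm c}^n\mid\exists\eta\in\mathbb R^{n_v}:\ \eta-CX\subseteq\mathbb V\}.$$ Let $\mathcal U$ be the set of all (possibly discontinuous) maps $\mu:\mathbb K_{\mathrm c}^n\to\mathbb U$. For $\mathfrak X\in\mathbb I^n$ and $\mu\in\mathcal U$ define $$F(\mathfrak X,\mu)=\{X^+\in\mathbb K_{\mathrm c}^n\mid\exists X\in\mathfrak X\sqcap\mathfrak V:\ X^+\subseteq AX+B\mu(X)+\mathbb W\},\qquad \overline F(\mathfrak X,\mu)=\mathrm{cl}(F(\mathfrak X,\mu)),$$ where sums of sets are Minkowski sums. An information tube is a sequence $\mathfrak X_0,\mathfrak X_1,\ldots\in\mathbb I^n$ for which there are $\mu_0,\mu_1,\ldots\in\mathcal U$ with $\mathfrak X_{k+1}\supseteq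 F(\mathfrak X_k,\mu_k)$ for all $k\in\mathbb N=\{0,1,2,\ldots\}$. It is tight if $\mathfrak X_{k+1}=\overline F(\mathfrak X_k,\mu_k)$ for all $k\in\mathbb N$ for at least one sequence $\mu_k\in\mathcal U$. *)

theory Defs
  imports "HOL-Analysis.Analysis"
begin

definition is_norm :: "('a::real_vector \<Rightarrow> real) \<Rightarrow> bool" where
  "is_norm N \<longleftrightarrow>
     (\<forall>x. 0 \<le> N x) \<and> (\<forall>x. N x = 0 \<longleftrightarrow> x = 0) \<and>
     (\<forall>c x. N (c *\<^sub>R x) = \<bar>c\<bar> * N x) \<and> (\<forall>x y. N (x + y) \<le> N x + N y)"

abbreviation compact_sets :: "'a::topological_space set set" where
  "compact_sets \<equiv> {X. compact X}"

text \<open>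
  In \<^typ>\<open>ennreal\<close>, the supremum over the empty set is \<open>0\<close> and the infimum over the empty set is
  \<open>\<infinity>\<close>, so the usual formula also covers the empty set; see the two lemmas below.
\<close>

definition hausdorff_dist :: "('a::real_vector \<Rightarrow> real) \<Rightarrow> 'a set \<Rightarrow> 'a set \<Rightarrow> ennreal" where
  "hausdorff_dist N X Y =
     max (SUP x\<in>X. INF y\<in>Y. ennreal (N (x - y))) (SUP y\<in>Y. INF x\<in>X. ennreal (N (x - y)))"

lemma hausdorff_dist_empty [simp]: "hausdorff_dist N {} {} = 0"
  by (simp add: hausdorff_dist_def bot_ennreal)

lemma hausdorff_dist_empty_right [simp]:
  assumes "X \<noteq> {}" shows "hausdorff_dist N X {} = \<infinity>"
  using assms by (simp add: hausdorff_dist_def bot_ennreal)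

lemma hausdorff_dist_empty_left [simp]:
  assumes "X \<noteq> {}" shows "hausdorff_dist N {} X = \<infinity>"
  using assms by (simp add: hausdorff_dist_def bot_ennreal)

text \<open>
  The distance takes the value \<open>\<infinity>\<close>, hence \<^locale>\<open>Metric_space\<close> does not apply; the topology on the
  compact sets is generated by the open balls directly.
\<close>

definition hausdorff_topology ::
    "('a::real_normed_vector \<Rightarrow> real) \<Rightarrow> 'a set topology" where
  "hausdorff_topology N = topology (\<lambda>\<UU>. \<UU> \<subseteq> compact_sets \<and>
     (\<forall>X\<in>\<UU>. \<exists>e>0. \<forall>Y\<in>compact_sets. hausdorff_dist N X Y < e \<longrightarrow> Y \<in> \<UU>))"

lemma openin_hausdorff_topology:
  "openin (hausdorff_topology N) \<UU> \<longleftrightarrow> \<UU> \<subseteq> compact_sets \<and>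
     (\<forall>X\<in>\<UU>. \<exists>e>0. \<forall>Y\<in>compact_sets. hausdorff_dist N X Y < e \<longrightarrow> Y \<in> \<UU>)"
proof -
  let ?P = "\<lambda>\<UU>. \<UU> \<subseteq> compact_sets \<and>
     (\<forall>X\<in>\<UU>. \<exists>e>0. \<forall>Y\<in>compact_sets. hausdorff_dist N X Y < e \<longrightarrow> Y \<in> \<UU>)"
  have "istopology ?P"
    unfolding istopology_def
  proof (intro conjI allI impI)
    fix S T assume S: "?P S" and T: "?P T"
    show "S \<inter> T \<subseteq> compact_sets" using S by blast
    show "\<forall>X\<in>S \<inter> T. \<exists>e>0. \<forall>Y\<in>compact_sets. hausdorff_dist N X Y < e \<longrightarrow> Y \<in> S \<inter> T"
    proof
      fix X assume "X \<in> S \<inter> T"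
      then have X: "X \<in> S" "X \<in> T" by blast+
      obtain d where d: "d > 0" "\<forall>Y\<in>compact_sets. hausdorff_dist N X Y < d \<longrightarrow> Y \<in> S"
        using S X(1) by blast
      obtain e where e: "e > 0" "\<forall>Y\<in>compact_sets. hausdorff_dist N X Y < e \<longrightarrow> Y \<in> T"
        using T X(2) by blast
      from d e show "\<exists>e>0. \<forall>Y\<in>compact_sets. hausdorff_dist N X Y < e \<longrightarrow> Y \<in> S \<inter> T"
        by (intro exI[of _ "min d e"]) auto
    qed
  next
    fix \<K> assume K: "\<forall>K\<in>\<K>. ?P K"
    show "\<Union>\<K> \<subseteq> compact_sets" using K by blast
    show "\<forall>X\<in>\<Union>\<K>. \<exists>e>0. \<forall>Y\<in>compact_sets. hausdorff_dist N X Y < e \<longrightarrow> Y \<in> \<Union>\<K>"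
    proof
      fix X assume "X \<in> \<Union>\<K>"
      then obtain S where "S \<in> \<K>" "X \<in> S" by blast
      then obtain e where "e > 0" "\<forall>Y\<in>compact_sets. hausdorff_dist N X Y < e \<longrightarrow> Y \<in> S"
        using K by blast
      then show "\<exists>e>0. \<forall>Y\<in>compact_sets. hausdorff_dist N X Y < e \<longrightarrow> Y \<in> \<Union>\<K>"
        using \<open>S \<in> \<K>\<close> by (intro exI[of _ e]) blast
    qed
  qed
  then show ?thesis
    by (simp add: hausdorff_topology_def)
qed

lemma topspace_hausdorff_topology [simp]: "topspace (hausdorff_topology N) = compact_sets"
proof -
  have "openin (hausdorff_topology N) compact_sets"
    unfolding openin_hausdorff_topology by (auto intro!: exI[of _ 1])
  then show ?thesis
    by (metis openin_hausdorff_topology openin_subset openin_topspace subset_antisym)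
qed

definition info_ensemble :: "'a::topological_space set set \<Rightarrow> bool" where
  "info_ensemble \<XX> \<longleftrightarrow>
     \<XX> \<noteq> {} \<and> \<XX> \<subseteq> compact_sets \<and> (\<forall>X\<in>\<XX>. \<forall>Y\<in>compact_sets. X \<inter> Y \<in> \<XX>)"

definition closed_info_ensembles ::
    "('a::real_normed_vector \<Rightarrow> real) \<Rightarrow> 'a set set set" where
  "closed_info_ensembles N = {\<XX>. info_ensemble \<XX> \<and> closedin (hausdorff_topology N) \<XX>}"

definition compact_info_ensembles ::
    "('a::real_normed_vector \<Rightarrow> real) \<Rightarrow> 'a set set set" where
  "compact_info_ensembles N = {\<XX>. info_ensemble \<XX> \<and> compactin (hausdorff_topology N) \<XX>}"

definition sqmeet :: "'a set set \<Rightarrow> 'a set set \<Rightarrow> 'a set set"  (infixl "\<sqinter>\<^sub>c" 70) where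
  "\<XX> \<sqinter>\<^sub>c \<YY> = {X \<inter> Y | X Y. X \<in> \<XX> \<and> Y \<in> \<YY>}"

definition translation_rel :: "'a::real_normed_vector set rel" where
  "translation_rel =
     {(X, Y). X \<in> compact_sets \<and> Y \<in> compact_sets \<and> (\<exists>a. (\<lambda>x. x + a) ` X = Y)}"

definition intrinsically_equiv ::
    "'a::real_normed_vector set set \<Rightarrow> 'a set set \<Rightarrow> bool"  (infix "\<sim>\<^sub>i" 50) where
  "\<XX> \<sim>\<^sub>i \<YY> \<longleftrightarrow> \<XX> // translation_rel = \<YY> // translation_rel"

lemma equiv_translation_rel: "equiv compact_sets (translation_rel :: 'a::real_normed_vector set rel)"
proof (rule equivI)
  show "translation_rel \<subseteq> compact_sets \<times> (compact_sets :: 'a set set)"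
    by (auto simp: translation_rel_def)
  show "refl_on compact_sets (translation_rel :: 'a set rel)"
    by (auto simp: refl_on_def translation_rel_def intro!: exI[of _ 0])
  show "sym (translation_rel :: 'a set rel)"
  proof (rule symI)
    fix X Y :: "'a set" assume "(X, Y) \<in> translation_rel"
    then obtain a where "compact X" "compact Y" "(\<lambda>x. x + a) ` X = Y"
      by (auto simp: translation_rel_def)
    moreover from this have "(\<lambda>x. x + (- a)) ` Y = X"
      by (force simp: image_image)
    ultimately show "(Y, X) \<in> translation_rel"
      unfolding translation_rel_def by blast
  qed
  show "trans (translation_rel :: 'a set rel)"
  proof (rule transI)
    fix X Y Z :: "'a set"
    assume "(X, Y) \<in> translation_rel" "(Y, Z) \<in> translation_rel"
    then obtain a b where "compact X" "compact Z" "(\<lambda>x. x + a) ` X = Y" "(\<lambda>x. x + b) ` Y = Z"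
      by (auto simp: translation_rel_def)
    moreover from this have "(\<lambda>x. x + (a + b)) ` X = Z"
      by (auto simp: image_image add.assoc)
    ultimately show "(X, Z) \<in> translation_rel"
      unfolding translation_rel_def by blast
  qed
qed

lemma intrinsically_equiv_iff:
  assumes "\<XX> \<subseteq> compact_sets" "\<YY> \<subseteq> compact_sets"
  shows "\<XX> \<sim>\<^sub>i \<YY> \<longleftrightarrow>
    (\<forall>X\<in>\<XX>. \<exists>a. (\<lambda>x. x + a) ` X \<in> \<YY>) \<and> (\<forall>Y\<in>\<YY>. \<exists>b. (\<lambda>x. x + b) ` Y \<in> \<XX>)"
proof -
  have sub: "\<XX> // translation_rel \<subseteq> \<YY> // translation_rel \<longleftrightarrow>
      (\<forall>X\<in>\<XX>. \<exists>a. (\<lambda>x. x + a) ` X \<in> \<YY>)"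
    if "\<XX> \<subseteq> compact_sets" "\<YY> \<subseteq> compact_sets" for \<XX> \<YY> :: "'a set set"
  proof -
    have "\<XX> // translation_rel \<subseteq> \<YY> // translation_rel \<longleftrightarrow>
        (\<forall>X\<in>\<XX>. \<exists>Y\<in>\<YY>. translation_rel `` {X} = translation_rel `` {Y})"
      by (auto simp: quotient_def)
    also have "\<dots> \<longleftrightarrow> (\<forall>X\<in>\<XX>. \<exists>a. (\<lambda>x. x + a) ` X \<in> \<YY>)"
    proof (rule ball_cong[OF refl])
      fix X assume "X \<in> \<XX>"
      with that(1) have X: "X \<in> compact_sets" by (rule subsetD)
      have "(\<exists>Y\<in>\<YY>. translation_rel `` {X} = translation_rel `` {Y}) \<longleftrightarrow>
          (\<exists>Y\<in>\<YY>. (X, Y) \<in> translation_rel)"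
        using eq_equiv_class_iff[OF equiv_translation_rel X] subsetD[OF that(2)]
        by (intro bex_cong[OF refl]) simp
      also have "\<dots> \<longleftrightarrow> (\<exists>Y\<in>\<YY>. \<exists>a. (\<lambda>x. x + a) ` X = Y)"
        using X subsetD[OF that(2)] by (intro bex_cong[OF refl]) (simp add: translation_rel_def)
      also have "\<dots> \<longleftrightarrow> (\<exists>a. (\<lambda>x. x + a) ` X \<in> \<YY>)"
        by auto
      finally show "(\<exists>Y\<in>\<YY>. translation_rel `` {X} = translation_rel `` {Y}) \<longleftrightarrow>
          (\<exists>a. (\<lambda>x. x + a) ` X \<in> \<YY>)" .
    qed
    finally show ?thesis .
  qed
  show ?thesis
    unfolding intrinsically_equiv_def set_eq_subset using sub assms by simp
qed

definition meas_ensemble :: "real^'n^'v \<Rightarrow> (real^'v) set \<Rightarrow> (real^'n) set set" where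
  "meas_ensemble C V = {X \<in> compact_sets. \<exists>\<eta>. (\<lambda>x. \<eta> - C *v x) ` X \<subseteq> V}"

text \<open>Values of a control map outside the compact sets are irrelevant.\<close>

definition control_maps :: "(real^'u) set \<Rightarrow> ((real^'n) set \<Rightarrow> real^'u) set" where
  "control_maps U = compact_sets \<rightarrow> U"

text \<open>The sum of sets below is the Minkowski sum of \<^theory>\<open>HOL-Library.Set_Algebras\<close>.\<close>

definition propagate ::
    "real^'n^'n \<Rightarrow> real^'u^'n \<Rightarrow> real^'n^'v \<Rightarrow> (real^'n) set \<Rightarrow> (real^'v) set \<Rightarrow>
     (real^'n) set set \<Rightarrow> ((real^'n) set \<Rightarrow> real^'u) \<Rightarrow> (real^'n) set set" where
  "propagate A B C W V \<XX> \<mu> = {X' \<in> compact_sets.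
     \<exists>X \<in> \<XX> \<sqinter>\<^sub>c meas_ensemble C V. X' \<subseteq> (\<lambda>x. A *v x) ` X + {B *v \<mu> X} + W}"

definition closed_propagate ::
    "(real^'n \<Rightarrow> real) \<Rightarrow> real^'n^'n \<Rightarrow> real^'u^'n \<Rightarrow> real^'n^'v \<Rightarrow> (real^'n) set \<Rightarrow>
     (real^'v) set \<Rightarrow> (real^'n) set set \<Rightarrow> ((real^'n) set \<Rightarrow> real^'u) \<Rightarrow> (real^'n) set set" where
  "closed_propagate N A B C W V \<XX> \<mu> =
     hausdorff_topology N closure_of propagate A B C W V \<XX> \<mu>"

definition information_tube ::
    "(real^'n \<Rightarrow> real) \<Rightarrow> real^'n^'n \<Rightarrow> real^'u^'n \<Rightarrow> real^'n^'v \<Rightarrow> (real^'u) set \<Rightarrow>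
     (real^'n) set \<Rightarrow> (real^'v) set \<Rightarrow> (nat \<Rightarrow> (real^'n) set set) \<Rightarrow> bool" where
  "information_tube N A B C U W V \<XX> \<longleftrightarrow>
     (\<forall>k. \<XX> k \<in> closed_info_ensembles N) \<and>
     (\<exists>\<mu>. (\<forall>k. \<mu> k \<in> control_maps U) \<and>
          (\<forall>k. propagate A B C W V (\<XX> k) (\<mu> k) \<subseteq> \<XX> (Suc k)))"

definition tight_information_tube ::
    "(real^'n \<Rightarrow> real) \<Rightarrow> real^'n^'n \<Rightarrow> real^'u^'n \<Rightarrow> real^'n^'v \<Rightarrow> (real^'u) set \<Rightarrow>
     (real^'n) set \<Rightarrow> (real^'v) set \<Rightarrow> (nat \<Rightarrow> (real^'n) set set) \<Rightarrow> bool" where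
  "tight_information_tube N A B C U W V \<XX> \<longleftrightarrow>
     information_tube N A B C U W V \<XX> \<and>
     (\<exists>\<mu>. (\<forall>k. \<mu> k \<in> control_maps U) \<and>
          (\<forall>k. \<XX> (Suc k) = closed_propagate N A B C W V (\<XX> k) (\<mu> k)))"

end

theory Submission
  imports Defs
begin

text \<open>
  Translating a set of states \<open>X\<close> by \<open>a\<close> translates the measurements \<open>C X\<close> by \<open>C a\<close>, which the free
  choice of \<open>\<eta>\<close> absorbs, and it translates \<open>A X + B \<mu>(X) + W\<close> by a constant vector. Two control maps
  also differ only by a constant vector as long as a single \<open>X\<close> is considered. Hence the
  unclosed propagation respects intrinsic equivalence, whatever the two control maps are
  (lemma \<open>propagate_translate\<close>).

  The difficulty is the closure: the translation vectors belonging to a convergent sequence of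
  sets need not converge. It is resolved by the fact that the translation orbit of a
  \<^emph>\<open>compact\<close> collection \<open>\<YY>\<close>, that is, the set of all compact sets with a translate in \<open>\<YY>\<close>,
  is closed (lemma \<open>closedin_translates_into\<close>). Applied to the next ensemble of one tube, which
  contains the unclosed propagation, this orbit contains the unclosed propagation of the other tube
  and therefore also its closure. The theorem follows by induction and symmetry.

  That the orbit of \<open>\<YY>\<close> is closed rests on two facts. Translations are isometries of the Hausdorff
  distance; and a compact set \<open>Z\<close> that is not a translate of \<open>X\<close> has positive distance from the
  set of all translates of \<open>X\<close> (lemma \<open>translate_of_approx_translates\<close>). Compactness of \<open>\<YY>\<close>
  makes this distance uniform in \<open>Z \<in> \<YY>\<close>.
\<close>

section \<open>Norms on Euclidean space\<close>

lemma is_norm_minus_commute: "is_norm N \<Longrightarrow> N (x - y) = N (y - x)"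
  unfolding is_norm_def by (metis abs_minus_cancel abs_one minus_diff_eq mult_1 scaleR_minus1_left)

text \<open>
  One half of the equivalence of norms in finite dimension: \<open>N\<close> is convex, hence continuous, and
  attains a positive minimum on the Euclidean unit sphere.
\<close>

lemma is_norm_bounded_below:
  fixes N :: "'a::euclidean_space \<Rightarrow> real"
  assumes N: "is_norm N"
  obtains m where "m > 0" "\<And>x. m * norm x \<le> N x"
proof -
  have "convex_on UNIV N"
  proof (rule convex_onI)
    fix t x y assume "0 < t" "t < (1::real)"
    then show "N ((1 - t) *\<^sub>R x + t *\<^sub>R y) \<le> (1 - t) * N x + t * N y"
      using N unfolding is_norm_def
      by (metis abs_of_pos diff_gt_0_iff_gt)
  qed simp
  then have cont: "continuous_on (sphere 0 1) N"
    using convex_on_continuous[OF open_UNIV] continuous_on_subset by blast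
  have "sphere (0::'a) 1 \<noteq> {}"
    by simp
  then obtain u where u: "u \<in> sphere 0 1" "\<And>y. y \<in> sphere 0 1 \<Longrightarrow> N u \<le> N y"
    using continuous_attains_inf[OF compact_sphere _ cont] by blast
  show ?thesis
  proof
    show "N u > 0"
      using N u(1) unfolding is_norm_def
      by (metis less_eq_real_def dist_0_norm mem_sphere norm_zero zero_neq_one)
    fix x :: 'a
    show "N u * norm x \<le> N x"
    proof (cases "x = 0")
      case False
      then have "N u \<le> N ((1 / norm x) *\<^sub>R x)"
        by (intro u(2)) simp
      also have "\<dots> = N x / norm x"
        using N by (simp add: is_norm_def)
      finally show ?thesis
        using False by (simp add: field_simps)
    qed (use N in \<open>simp add: is_norm_def\<close>)
  qed
qed

lemma tendsto_zero_if_is_norm_tendsto_zero: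
  fixes N :: "'a::euclidean_space \<Rightarrow> real"
  assumes "is_norm N" "(\<lambda>n. N (f n)) \<longlonglongrightarrow> 0"
  shows "f \<longlonglongrightarrow> 0"
proof -
  obtain m where m: "m > 0" "\<And>x. m * norm x \<le> N x"
    using is_norm_bounded_below[OF assms(1)] by blast
  have "(\<lambda>n. N (f n) / m) \<longlonglongrightarrow> 0"
    using tendsto_divide[OF assms(2) tendsto_const, of m] m(1) by simp
  then show ?thesis
    by (rule Lim_null_comparison[rotated]) (use m in \<open>auto simp: field_simps\<close>)
qed

section \<open>The Hausdorff distance\<close>

definition hausdorff_excess :: "('a::real_vector \<Rightarrow> real) \<Rightarrow> 'a set \<Rightarrow> 'a set \<Rightarrow> ennreal" where
  "hausdorff_excess N X Y = (SUP x\<in>X. INF y\<in>Y. ennreal (N (x - y)))"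

lemma hausdorff_dist_eq_max_excess:
  "is_norm N \<Longrightarrow> hausdorff_dist N X Y = max (hausdorff_excess N X Y) (hausdorff_excess N Y X)"
  unfolding hausdorff_dist_def hausdorff_excess_def by (simp add: is_norm_minus_commute[of N])

lemma hausdorff_dist_commute: "is_norm N \<Longrightarrow> hausdorff_dist N X Y = hausdorff_dist N Y X"
  by (simp add: hausdorff_dist_eq_max_excess max.commute)

text \<open>Addition of a constant is monotone and continuous, so it commutes with nonempty infima.\<close>

lemma INF_add_const_le_ennreal:
  fixes f :: "'i \<Rightarrow> ennreal"
  shows "(INF i\<in>I. f i + c) \<le> (INF i\<in>I. f i) + c"
proof (cases "I = {}")
  case False
  then show ?thesis
    using continuous_at_Inf_mono[of "\<lambda>x. x + c" "f ` I"]
      continuous_add[of "at_right (Inf (f ` I))", of "\<lambda>x. x" "\<lambda>x. c"]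
    by (auto simp: mono_def image_comp o_def add_right_mono)
qed simp

lemma hausdorff_excess_triangle:
  assumes N: "is_norm N"
  shows "hausdorff_excess N X Z \<le> hausdorff_excess N X Y + hausdorff_excess N Y Z"
  unfolding hausdorff_excess_def[of N X Z]
proof (rule SUP_least)
  fix x assume x: "x \<in> X"
  have "(INF z\<in>Z. ennreal (N (x - z))) \<le> ennreal (N (x - y)) + hausdorff_excess N Y Z"
    if y: "y \<in> Y" for y
  proof -
    have "(INF z\<in>Z. ennreal (N (x - z))) \<le> (INF z\<in>Z. ennreal (N (x - y)) + ennreal (N (y - z)))"
    proof (rule INF_mono)
      fix z assume z: "z \<in> Z"
      have "N (x - z) \<le> N (x - y) + N (y - z)"
        using N unfolding is_norm_def by (metis add_diff_eq diff_add_cancel)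
      then have "ennreal (N (x - z)) \<le> ennreal (N (x - y)) + ennreal (N (y - z))"
        using N by (simp add: is_norm_def flip: ennreal_plus)
      with z show "\<exists>z'\<in>Z. ennreal (N (x - z')) \<le> ennreal (N (x - y)) + ennreal (N (y - z))"
        by blast
    qed
    also have "\<dots> \<le> ennreal (N (x - y)) + (INF z\<in>Z. ennreal (N (y - z)))"
      using INF_add_const_le_ennreal[of "\<lambda>z. ennreal (N (y - z))" "ennreal (N (x - y))" Z]
      by (simp add: add.commute)
    also have "\<dots> \<le> ennreal (N (x - y)) + hausdorff_excess N Y Z"
      unfolding hausdorff_excess_def by (intro add_left_mono SUP_upper y)
    finally show ?thesis .
  qed
  then have "(INF z\<in>Z. ennreal (N (x - z))) \<le>
      (INF y\<in>Y. ennreal (N (x - y)) + hausdorff_excess N Y Z)"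
    by (rule INF_greatest)
  also have "\<dots> \<le> (INF y\<in>Y. ennreal (N (x - y))) + hausdorff_excess N Y Z"
    by (rule INF_add_const_le_ennreal)
  also have "\<dots> \<le> hausdorff_excess N X Y + hausdorff_excess N Y Z"
    unfolding hausdorff_excess_def[of N X Y] by (intro add_right_mono SUP_upper x)
  finally show "(INF z\<in>Z. ennreal (N (x - z))) \<le> hausdorff_excess N X Y + hausdorff_excess N Y Z" .
qed

lemma hausdorff_dist_triangle:
  assumes "is_norm N"
  shows "hausdorff_dist N X Z \<le> hausdorff_dist N X Y + hausdorff_dist N Y Z"
proof -
  have "hausdorff_excess N X Z \<le> hausdorff_dist N X Y + hausdorff_dist N Y Z"
    "hausdorff_excess N Z X \<le> hausdorff_dist N Y Z + hausdorff_dist N X Y"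
    by (rule order_trans[OF hausdorff_excess_triangle[OF assms, of _ _ Y]];
        auto simp: hausdorff_dist_eq_max_excess[OF assms] intro!: add_mono)+
  then show ?thesis
    by (simp add: hausdorff_dist_eq_max_excess[OF assms, of X Z] add.commute)
qed

lemma hausdorff_dist_self:
  assumes "is_norm N" shows "hausdorff_dist N X X = 0"
proof -
  have "hausdorff_excess N X X \<le> 0"
    unfolding hausdorff_excess_def
  proof (rule SUP_least)
    fix x assume "x \<in> X"
    moreover have "N (x - x) = 0"
      using assms unfolding is_norm_def by simp
    ultimately show "(INF y\<in>X. ennreal (N (x - y))) \<le> 0"
      by (metis INF_lower ennreal_0)
  qed
  then show ?thesis
    by (simp add: hausdorff_dist_eq_max_excess[OF assms])
qed

lemma hausdorff_dist_translate:
  "hausdorff_dist N ((\<lambda>x. x + c) ` X) ((\<lambda>x. x + c) ` Y) = hausdorff_dist N X Y"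
  unfolding hausdorff_dist_def by (simp add: image_image)

lemma hausdorff_dist_lessD:
  assumes N: "is_norm N" and less: "hausdorff_dist N X Y < ennreal e"
  shows "x \<in> X \<Longrightarrow> \<exists>y\<in>Y. N (x - y) < e" and "y \<in> Y \<Longrightarrow> \<exists>x\<in>X. N (x - y) < e"
proof -
  have *: "ennreal (N v) < ennreal e \<longleftrightarrow> N v < e" for v
    using N by (simp add: is_norm_def ennreal_less_iff)
  have sup: "(SUP x\<in>X. INF y\<in>Y. ennreal (N (x - y))) < ennreal e"
    "(SUP y\<in>Y. INF x\<in>X. ennreal (N (x - y))) < ennreal e"
    using less unfolding hausdorff_dist_def by simp_all
  show "\<exists>y\<in>Y. N (x - y) < e" if "x \<in> X"
  proof -
    have "(INF y\<in>Y. ennreal (N (x - y))) < ennreal e"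
      using sup(1) that by (meson SUP_upper le_less_trans)
    then show ?thesis by (simp add: INF_less_iff *)
  qed
  show "\<exists>x\<in>X. N (x - y) < e" if "y \<in> Y"
  proof -
    have "(INF x\<in>X. ennreal (N (x - y))) < ennreal e"
      using sup(2) that by (meson SUP_upper le_less_trans)
    then show ?thesis by (simp add: INF_less_iff *)
  qed
qed

lemma openin_hausdorff_ball:
  assumes N: "is_norm N"
  shows "openin (hausdorff_topology N) {Y \<in> compact_sets. hausdorff_dist N X Y < r}"
  unfolding openin_hausdorff_topology
proof (intro conjI ballI)
  fix Y assume "Y \<in> {Y \<in> compact_sets. hausdorff_dist N X Y < r}"
  then have "hausdorff_dist N X Y < r" by blast
  then obtain e where e: "hausdorff_dist N X Y + e < r" "0 < e"
    by (metis add.commute dense diff_gt_0_iff_gt_ennreal less_diff_eq_ennreal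
        ennreal_zero_less_top top.not_eq_extremum order_less_imp_not_less)
  have "hausdorff_dist N X Z < r" if "hausdorff_dist N Y Z < e" for Z
    using hausdorff_dist_triangle[OF N, of X Z Y] that e(1)
    by (meson add_left_mono le_less_trans less_imp_le)
  then show "\<exists>e>0. \<forall>Z\<in>compact_sets. hausdorff_dist N Y Z < e \<longrightarrow>
      Z \<in> {Y \<in> compact_sets. hausdorff_dist N X Y < r}"
    using e(2) by blast
qed blast

section \<open>Translation orbits\<close>

text \<open>
  Each approximate translation vector moves a fixed point of \<open>X\<close> close to the compact set \<open>Z\<close>, so
  these vectors have a convergent subsequence; its limit translates \<open>X\<close> onto \<open>Z\<close>, because both sets
  are closed. The empty set says nothing about the vectors, but it is infinitely far from all other
  sets.
\<close>

lemma translate_of_approx_translates: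
  fixes X Z :: "'a::euclidean_space set"
  assumes N: "is_norm N" and "compact X" "compact Z"
    and approx: "\<And>e. e > 0 \<Longrightarrow> \<exists>c. hausdorff_dist N Z ((\<lambda>x. x + c) ` X) < ennreal e"
  shows "\<exists>c. Z = (\<lambda>x. x + c) ` X"
proof (cases "X = {}")
  case True
  then show ?thesis
    using approx[of 1] by (cases "Z = {}") auto
next
  case False
  then obtain x0 where x0: "x0 \<in> X" by blast
  define e where "e n = 1 / real (Suc n)" for n
  have e_pos: "e n > 0" for n by (simp add: e_def)
  have e_lim: "e \<longlonglongrightarrow> 0"
    unfolding e_def using LIMSEQ_inverse_real_of_nat by (simp add: inverse_eq_divide)
  obtain c where c: "\<And>n. hausdorff_dist N Z ((\<lambda>x. x + c n) ` X) < ennreal (e n)"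
    using approx[OF e_pos] by metis
  have near_Z: "\<exists>z\<in>Z. N (z - (x + c n)) < e n" if "x \<in> X" for x n
    using hausdorff_dist_lessD(2)[OF N c[of n], of "x + c n"] that by blast
  have near_X: "\<exists>x\<in>X. N (z - (x + c n)) < e n" if "z \<in> Z" for z n
    using hausdorff_dist_lessD(1)[OF N c[of n] that] by blast
  have null: "f \<longlonglongrightarrow> 0" if "\<And>n. N (f n) < e n" for f
  proof (rule tendsto_zero_if_is_norm_tendsto_zero[OF N])
    show "(\<lambda>n. N (f n)) \<longlonglongrightarrow> 0"
      by (rule tendsto_sandwich[OF _ _ tendsto_const e_lim])
        (use N that in \<open>auto simp: is_norm_def intro!: always_eventually less_imp_le\<close>)
  qed
  obtain z where z: "\<And>n. z n \<in> Z" "\<And>n. N (z n - (x0 + c n)) < e n"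
    using near_Z[OF x0] by metis
  obtain l r where r: "strict_mono r" "(z \<circ> r) \<longlonglongrightarrow> l"
    using \<open>compact Z\<close> z(1) unfolding compact_def by metis
  have null_r: "(\<lambda>n. f (r n)) \<longlonglongrightarrow> 0" if "\<And>n. N (f n) < e n" for f
    using LIMSEQ_subseq_LIMSEQ[OF null[OF that] r(1)] by (simp add: o_def)
  define a where "a = l - x0"
  have c_lim: "(\<lambda>n. c (r n)) \<longlonglongrightarrow> a"
    using tendsto_diff[OF tendsto_diff[OF r(2) null_r[OF z(2)]] tendsto_const[of x0]]
    by (simp add: o_def a_def)
  have "x + a \<in> Z" if x: "x \<in> X" for x
  proof -
    obtain y where y: "\<And>n. y n \<in> Z" "\<And>n. N (y n - (x + c n)) < e n"
      using near_Z[OF x] by metis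
    have "(\<lambda>n. y (r n)) \<longlonglongrightarrow> x + a"
      using tendsto_add[OF null_r[OF y(2)] tendsto_add[OF tendsto_const[of x] c_lim]] by simp
    then show ?thesis
      using compact_imp_closed[OF \<open>compact Z\<close>] y(1) by (meson closed_sequentially)
  qed
  moreover have "w - a \<in> X" if w: "w \<in> Z" for w
  proof -
    obtain y where y: "\<And>n. y n \<in> X" "\<And>n. N (w - (y n + c n)) < e n"
      using near_X[OF w] by metis
    have "(\<lambda>n. y (r n)) \<longlonglongrightarrow> w - a"
      using tendsto_diff[OF tendsto_diff[OF tendsto_const[of w] c_lim] null_r[OF y(2)]]
      by (simp add: algebra_simps)
    then show ?thesis
      using compact_imp_closed[OF \<open>compact X\<close>] y(1) by (meson closed_sequentially)
  qed
  ultimately have "Z = (\<lambda>x. x + a) ` X"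
    by (auto simp: image_iff) (metis diff_add_cancel)
  then show ?thesis ..
qed

text \<open>
  Let \<open>X\<close> have no translate in \<open>\<YY>\<close>. Each \<open>Z \<in> \<YY>\<close> is then at least \<open>2 r Z\<close> away from all translates
  of \<open>X\<close>, so finitely many balls of radius \<open>r Z\<close> cover \<open>\<YY>\<close> and keep all of \<open>\<YY>\<close> away from all
  translates of \<open>X\<close> by the smallest radius. As translations are isometries, the ball of this radius
  around \<open>X\<close> contains no set with a translate in \<open>\<YY>\<close>.
\<close>

lemma closedin_translates_into:
  fixes \<YY> :: "'a::euclidean_space set set"
  assumes N: "is_norm N" and \<YY>: "compactin (hausdorff_topology N) \<YY>"
  shows "closedin (hausdorff_topology N) {X \<in> compact_sets. \<exists>c. (\<lambda>x. x + c) ` X \<in> \<YY>}"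
    (is "closedin _ ?\<TT>")
proof -
  have "\<exists>e>0. \<forall>Y\<in>compact_sets. hausdorff_dist N X Y < e \<longrightarrow> Y \<in> compact_sets - ?\<TT>"
    if "X \<in> compact_sets - ?\<TT>" for X
  proof -
    have X: "compact X" "\<And>c. (\<lambda>x. x + c) ` X \<notin> \<YY>"
      using that by auto
    have "\<exists>r>0. \<forall>c. ennreal (2 * r) \<le> hausdorff_dist N Z ((\<lambda>x. x + c) ` X)" if "Z \<in> \<YY>" for Z
    proof (rule ccontr)
      assume *: "\<not> ?thesis"
      have "\<exists>c. hausdorff_dist N Z ((\<lambda>x. x + c) ` X) < ennreal e" if "e > 0" for e
        using * that by (auto simp: not_le dest!: spec[of _ "e / 2"])
      moreover have "compact Z"
        using \<open>Z \<in> \<YY>\<close> compactin_subset_topspace[OF \<YY>] by auto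
      ultimately show False
        using translate_of_approx_translates[OF N X(1)] X(2) \<open>Z \<in> \<YY>\<close> by blast
    qed
    then obtain r :: "'a set \<Rightarrow> real" where r: "\<And>Z. Z \<in> \<YY> \<Longrightarrow> r Z > 0"
      "\<And>Z c. Z \<in> \<YY> \<Longrightarrow> ennreal (2 * r Z) \<le> hausdorff_dist N Z ((\<lambda>x. x + c) ` X)"
      by metis
    define ball where "ball Z = {Y \<in> compact_sets. hausdorff_dist N Z Y < ennreal (r Z)}" for Z
    have "openin (hausdorff_topology N) (ball Z)" for Z
      unfolding ball_def by (rule openin_hausdorff_ball[OF N])
    moreover have "\<YY> \<subseteq> \<Union>(ball ` \<YY>)"
    proof
      fix Z assume "Z \<in> \<YY>"
      then have "Z \<in> ball Z"
        using r(1) compactin_subset_topspace[OF \<YY>] by (auto simp: ball_def hausdorff_dist_self[OF N])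
      with \<open>Z \<in> \<YY>\<close> show "Z \<in> \<Union>(ball ` \<YY>)" by blast
    qed
    ultimately obtain \<BB> where \<BB>: "finite \<BB>" "\<BB> \<subseteq> ball ` \<YY>" "\<YY> \<subseteq> \<Union>\<BB>"
      using compactinD[OF \<YY>, of "ball ` \<YY>"] by blast
    obtain \<KK> where \<KK>: "finite \<KK>" "\<KK> \<subseteq> \<YY>" "\<YY> \<subseteq> \<Union>(ball ` \<KK>)"
      using finite_subset_image[OF \<BB>(1,2)] \<BB>(3) by metis
    \<comment> \<open>The extra element only provides a radius if \<open>\<KK>\<close> is empty.\<close>
    define e where "e = Min (insert 1 (r ` \<KK>))"
    have e_le: "e \<le> r Z" if "Z \<in> \<KK>" for Z
      unfolding e_def using that \<KK>(1) by (intro Min_le) auto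
    have e_pos: "e > 0"
      unfolding e_def using \<KK>(1,2) r(1) by (subst Min_gr_iff) auto
    have "Y \<notin> ?\<TT>" if less: "hausdorff_dist N X Y < ennreal e" for Y
    proof
      assume "Y \<in> ?\<TT>"
      then obtain c where c: "(\<lambda>x. x + c) ` Y \<in> \<YY>" (is "?Y \<in> _") by blast
      then obtain Z where Z: "Z \<in> \<KK>" "?Y \<in> ball Z" using \<KK>(3) by blast
      have "ennreal (2 * r Z) \<le> hausdorff_dist N Z ((\<lambda>x. x + c) ` X)"
        using r(2) Z(1) \<KK>(2) by blast
      also have "\<dots> \<le> hausdorff_dist N Z ?Y + hausdorff_dist N ?Y ((\<lambda>x. x + c) ` X)"
        by (rule hausdorff_dist_triangle[OF N])
      also have "hausdorff_dist N ?Y ((\<lambda>x. x + c) ` X) = hausdorff_dist N X Y"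
        by (simp add: hausdorff_dist_translate hausdorff_dist_commute[OF N])
      also have "hausdorff_dist N Z ?Y + hausdorff_dist N X Y < ennreal (r Z) + ennreal e"
        using Z(2) less by (intro add_strict_mono) (auto simp: ball_def)
      also have "\<dots> \<le> ennreal (r Z) + ennreal (r Z)"
        by (intro add_left_mono ennreal_leI e_le Z(1))
      also have "\<dots> = ennreal (2 * r Z)"
        using r(1)[of Z] Z(1) \<KK>(2) by (auto simp flip: ennreal_plus)
      finally show False by simp
    qed
    then show ?thesis
      using e_pos by (intro exI[of _ "ennreal e"]) auto
  qed
  then have "openin (hausdorff_topology N) (compact_sets - ?\<TT>)"
    unfolding openin_hausdorff_topology by blast
  then show ?thesis
    unfolding closedin_def by auto
qed

section \<open>Propagation and intrinsic equivalence\<close>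

lemma meas_ensemble_subset:
  "X \<in> meas_ensemble C V \<Longrightarrow> compact Y \<Longrightarrow> Y \<subseteq> X \<Longrightarrow> Y \<in> meas_ensemble C V"
  unfolding meas_ensemble_def by blast

lemma meas_ensemble_translate:
  assumes "X \<in> meas_ensemble C V"
  shows "(\<lambda>x. x + a) ` X \<in> meas_ensemble C V"
proof -
  obtain \<eta> where X: "compact X" "(\<lambda>x. \<eta> - C *v x) ` X \<subseteq> V"
    using assms by (auto simp: meas_ensemble_def)
  have "compact ((\<lambda>x. x + a) ` X)"
    using compact_translation[OF X(1), of a] by (simp add: add.commute)
  moreover have "(\<lambda>x. (\<eta> + C *v a) - C *v x) ` (\<lambda>x. x + a) ` X \<subseteq> V"
    using X(2) by (simp add: image_image matrix_vector_right_distrib)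
  ultimately show ?thesis
    unfolding meas_ensemble_def by blast
qed

lemma info_ensemble_sqmeet_meas_ensemble:
  assumes "info_ensemble \<XX>"
  shows "\<XX> \<sqinter>\<^sub>c meas_ensemble C V = \<XX> \<inter> meas_ensemble C V"
proof
  show "\<XX> \<inter> meas_ensemble C V \<subseteq> \<XX> \<sqinter>\<^sub>c meas_ensemble C V"
    unfolding sqmeet_def by blast
  show "\<XX> \<sqinter>\<^sub>c meas_ensemble C V \<subseteq> \<XX> \<inter> meas_ensemble C V"
  proof
    fix Z assume "Z \<in> \<XX> \<sqinter>\<^sub>c meas_ensemble C V"
    then obtain X Y where Z: "Z = X \<inter> Y" "X \<in> \<XX>" "Y \<in> meas_ensemble C V"
      unfolding sqmeet_def by blast
    have "compact Y"
      using Z(3) by (simp add: meas_ensemble_def)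
    then have "Z \<in> \<XX>" "compact Z"
      using assms Z unfolding info_ensemble_def by auto
    then show "Z \<in> \<XX> \<inter> meas_ensemble C V"
      using meas_ensemble_subset[OF Z(3)] Z(1) by blast
  qed
qed

text \<open>
  If \<open>X + a\<close> is the translate of \<open>X\<close> in \<open>\<YY>\<close>, the successors of \<open>X\<close> have to be translated by \<open>A a\<close> and
  by the difference between the control actions at \<open>X + a\<close> and at \<open>X\<close>.
\<close>

lemma propagate_translate:
  assumes \<XX>: "info_ensemble \<XX>" and \<YY>: "info_ensemble \<YY>"
    and into: "\<And>X. X \<in> \<XX> \<Longrightarrow> \<exists>a. (\<lambda>x. x + a) ` X \<in> \<YY>"
    and X': "X' \<in> propagate A B C W V \<XX> \<mu>"
  shows "\<exists>c. (\<lambda>x. x + c) ` X' \<in> propagate A B C W V \<YY> \<nu>"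
proof -
  obtain X where X: "X \<in> \<XX>" "X \<in> meas_ensemble C V" "compact X'"
    "X' \<subseteq> (\<lambda>x. A *v x) ` X + {B *v \<mu> X} + W"
    using X' unfolding propagate_def info_ensemble_sqmeet_meas_ensemble[OF \<XX>] by blast
  obtain a where a: "(\<lambda>x. x + a) ` X \<in> \<YY>"
    using into X(1) by blast
  define Y where "Y = (\<lambda>x. x + a) ` X"
  have Y: "Y \<in> \<YY> \<sqinter>\<^sub>c meas_ensemble C V"
    unfolding info_ensemble_sqmeet_meas_ensemble[OF \<YY>] Y_def
    using a meas_ensemble_translate[OF X(2)] by blast
  define c where "c = A *v a + B *v \<nu> Y - B *v \<mu> X"
  have "(\<lambda>x. x + c) ` X' \<subseteq> (\<lambda>x. A *v x) ` Y + {B *v \<nu> Y} + W"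
  proof (intro image_subsetI)
    fix x' assume "x' \<in> X'"
    then obtain x w where "x \<in> X" "w \<in> W" "x' = A *v x + B *v \<mu> X + w"
      using X(4) by (force elim!: set_plus_elim)
    moreover from this have "x' + c = A *v (x + a) + B *v \<nu> Y + w"
      by (simp add: c_def matrix_vector_right_distrib)
    ultimately show "x' + c \<in> (\<lambda>x. A *v x) ` Y + {B *v \<nu> Y} + W"
      by (metis Y_def imageI insertI1 set_plus_intro)
  qed
  moreover have "compact ((\<lambda>x. x + c) ` X')"
    using compact_translation[OF X(3), of c] by (simp add: add.commute)
  ultimately show ?thesis
    using Y unfolding propagate_def by blast
qed

text \<open>
  The closure is handled without following translation vectors to a limit: the sets with a translate
  in the compact target ensemble form a closed collection, which contains the unclosed propagation.
\<close>

lemma closed_propagate_translate: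
  assumes N: "is_norm N" and \<XX>: "info_ensemble \<XX>" and \<YY>: "info_ensemble \<YY>"
    and into: "\<And>X. X \<in> \<XX> \<Longrightarrow> \<exists>a. (\<lambda>x. x + a) ` X \<in> \<YY>"
    and compact: "compactin (hausdorff_topology N) (closed_propagate N A B C W V \<YY> \<nu>)"
    and X': "X' \<in> closed_propagate N A B C W V \<XX> \<mu>"
  shows "\<exists>c. (\<lambda>x. x + c) ` X' \<in> closed_propagate N A B C W V \<YY> \<nu>"
proof -
  let ?\<TT> = "{X \<in> compact_sets. \<exists>c. (\<lambda>x. x + c) ` X \<in> closed_propagate N A B C W V \<YY> \<nu>}"
  have propagate_compact: "propagate A B C W V \<ZZ> \<kappa> \<subseteq> compact_sets" for \<ZZ> \<kappa>
    by (auto simp: propagate_def)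
  have "propagate A B C W V \<YY> \<nu> \<subseteq> closed_propagate N A B C W V \<YY> \<nu>"
    unfolding closed_propagate_def
    by (intro closure_of_subset) (simp add: propagate_compact)
  then have "propagate A B C W V \<XX> \<mu> \<subseteq> ?\<TT>"
    using propagate_translate[OF \<XX> \<YY> into, of _ A B C W V \<mu> \<nu>] propagate_compact by blast
  then have "closed_propagate N A B C W V \<XX> \<mu> \<subseteq> ?\<TT>"
    unfolding closed_propagate_def[of N A B C W V \<XX> \<mu>]
    by (rule closure_of_minimal[OF _ closedin_translates_into[OF N compact]])
  with X' show ?thesis by blast
qed

theorem theorem1:
  fixes N :: "real^'n \<Rightarrow> real"
    and A :: "real^'n^'n" and B :: "real^'u^'n" and C :: "real^'n^'v"
    and U :: "(real^'u) set" and W :: "(real^'n) set" and V :: "(real^'v) set"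
    and \<XX> \<YY> :: "nat \<Rightarrow> (real^'n) set set"
  assumes "is_norm N"
    and "compact U" and "compact W" and "compact V"
    and "\<And>k. \<XX> k \<in> compact_info_ensembles N"
    and "\<And>k. \<YY> k \<in> compact_info_ensembles N"
    and "tight_information_tube N A B C U W V \<XX>"
    and "tight_information_tube N A B C U W V \<YY>"
    and "\<XX> 0 \<sim>\<^sub>i \<YY> 0"
  shows "\<forall>k. \<XX> k \<sim>\<^sub>i \<YY> k"
proof
  fix k
  have \<XX>: "info_ensemble (\<XX> k)" "compactin (hausdorff_topology N) (\<XX> k)"
    and \<YY>: "info_ensemble (\<YY> k)" "compactin (hausdorff_topology N) (\<YY> k)" for k
    using assms(5,6)[of k] by (simp_all add: compact_info_ensembles_def)
  have iff: "\<XX> k \<sim>\<^sub>i \<YY> k \<longleftrightarrow> (\<forall>X\<in>\<XX> k. \<exists>a. (\<lambda>x. x + a) ` X \<in> \<YY> k) \<and>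
      (\<forall>Y\<in>\<YY> k. \<exists>b. (\<lambda>x. x + b) ` Y \<in> \<XX> k)" for k
    using \<XX>(1)[of k] \<YY>(1)[of k] by (intro intrinsically_equiv_iff) (auto simp: info_ensemble_def)
  obtain \<mu> where \<mu>: "\<And>k. \<XX> (Suc k) = closed_propagate N A B C W V (\<XX> k) (\<mu> k)"
    using assms(7) unfolding tight_information_tube_def by blast
  obtain \<nu> where \<nu>: "\<And>k. \<YY> (Suc k) = closed_propagate N A B C W V (\<YY> k) (\<nu> k)"
    using assms(8) unfolding tight_information_tube_def by blast
  show "\<XX> k \<sim>\<^sub>i \<YY> k"
  proof (induction k)
    case 0
    show ?case by (rule assms(9))
  next
    case (Suc k)
    have "\<exists>a. (\<lambda>x. x + a) ` X \<in> \<YY> (Suc k)" if "X \<in> \<XX> (Suc k)" for X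
      using closed_propagate_translate[OF assms(1) \<XX>(1)[of k] \<YY>(1)[of k]] Suc.IH that
        \<YY>(2)[of "Suc k"] unfolding iff \<mu> \<nu> by blast
    moreover have "\<exists>b. (\<lambda>x. x + b) ` Y \<in> \<XX> (Suc k)" if "Y \<in> \<YY> (Suc k)" for Y
      using closed_propagate_translate[OF assms(1) \<YY>(1)[of k] \<XX>(1)[of k]] Suc.IH that
        \<XX>(2)[of "Suc k"] unfolding iff \<mu> \<nu> by blast
    ultimately show ?case
      unfolding iff by blast
  qed
qed

end
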